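(* Let $\mathcal{C}$ be a closed symmetric monoidal category and let $\mathcal{T}$ be a one-object category enriched over $\mathcal{C}$, with hom-object $T$, composition $\mu:T\otimes T\to T$ and unit $\iota:1_{\mathcal{C}}\to T$. Let $\tilde\Phi:\mathcal{T}\to\mathcal{C}$ be an enriched functor with domain $\Omega$ and let $\Phi:T\otimes\Omega\to\Omega$ be the adjoint of its parametric form $\Phi^\sharp:T\to[\Omega;\Omega]$. Then the transfer operator $\mathrm{Tr}_\Phi:T\otimes[T;\Omega]\to[T;\Omega]$ satisfies the identities of a left action: $\mathrm{Tr}_\Phi\circ(\iota\otimes[T;\Omega])$ is the canonical isomorphism $1_{\mathcal{C}}\otimes[T;\Omega]\cong[T;\Omega]$, and $\mathrm{Tr}_\Phi\circ(T\otimes\mathrm{Tr}_\Phi)=\mathrm{Tr}_\Phi\circ(\mu\otimes[T;\Omega])$. Thus $\mathrm{Tr}_\Phi$ is the flow form (the adjoint of the parametric form) of an enriched functor $\mathcal{T}\to\mathcal{C}$ whose domain is the path space $[T;\Omega]$.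
   Context: Time: the time semigroup $\mathcal{T}$ (with identity) is viewed as a one-object category enriched over $\mathcal{C}$; $(T,\mu,\iota)$ is then a monoid object in $\mathcal{C}$. Associators are suppressed. Internal homs: $[y;z]$ is the internal hom, with $\mathrm{Hom}(y\otimes x;z)\cong\mathrm{Hom}(x;[y;z])$ and evaluation $\mathrm{eval}:y\otimes[y;z]\to z$; $\mathcal{C}$ is enriched over itself via internal homs. Enriched functor: an enriched functor $\tilde\Psi:\mathcal{T}\to\mathcal{C}$ with domain $X$ (the image of the unique object of $\mathcal{T}$) is given by a morphism $\Psi^\sharp:T\to[X;X]$, its parametric form, such that $\Psi^\sharp\circ\iota$ is the internal identity $1_{\mathcal{C}}\to[X;X]$ and $\Psi^\sharp\circ\mu$ equals $\Psi^\sharp\otimes\Psi^\sharp$ followed by internal composition $[X;X]\otimes[X;X]\to[X;X]$. Transfer operator: $\mathrm{Tr}_\Phi:T\otimes[T;\Omega]\to[T;\Omega]$ is the adjoint, with respect to the first (leftmost) factor $T$, of the composite $T\otimes T\otimes[T;\Omega]\xrightarrow{\mathrm{swap}_{T,T}\otimes[T;\Omega]}T\otimes T\otimes[T;\Omega]\xrightarrow{T\otimes\mathrm{eval}}T\otimes\Omega\xrightarrow{\Phi}\Omega$, where $\mathrm{swap}$ is the symmetry of $\mathcal{C}$. *)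

theory Defs
  imports Main
begin

section \<open>Categories\<close>

text \<open>
  Arrows form one collection with domain and codomain maps; composition is in applicative
  order, \<open>g \<cdot> f\<close> being "first \<open>f\<close>, then \<open>g\<close>". Values outside the carriers are unconstrained.
\<close>

record ('o, 'a) category =
  Obj :: "'o set"
  Arr :: "'a set"
  Dom :: "'a \<Rightarrow> 'o"
  Cod :: "'a \<Rightarrow> 'o"
  Ident :: "'o \<Rightarrow> 'a"
  Comp :: "'a \<Rightarrow> 'a \<Rightarrow> 'a" (infixr \<open>\<cdot>\<index>\<close> 55)

definition hom :: "('o, 'a, 'm) category_scheme \<Rightarrow> 'o \<Rightarrow> 'o \<Rightarrow> 'a set" where
  "hom C x y = {f \<in> Arr C. Dom C f = x \<and> Cod C f = y}"

locale category =
  fixes C :: "('o, 'a, 'm) category_scheme" (structure)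
  assumes Dom_closed: "f \<in> Arr C \<Longrightarrow> Dom C f \<in> Obj C"
    and Cod_closed: "f \<in> Arr C \<Longrightarrow> Cod C f \<in> Obj C"
    and Id_hom: "x \<in> Obj C \<Longrightarrow> Ident C x \<in> hom C x x"
    and Comp_hom: "\<lbrakk>f \<in> hom C x y; g \<in> hom C y z\<rbrakk> \<Longrightarrow> g \<cdot> f \<in> hom C x z"
    and Comp_Id: "f \<in> hom C x y \<Longrightarrow> f \<cdot> Ident C x = f"
    and Id_Comp: "f \<in> hom C x y \<Longrightarrow> Ident C y \<cdot> f = f"
    and Comp_assoc:
      "\<lbrakk>f \<in> hom C w x; g \<in> hom C x y; h \<in> hom C y z\<rbrakk> \<Longrightarrow> (h \<cdot> g) \<cdot> f = h \<cdot> (g \<cdot> f)"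

definition is_inverse :: "('o, 'a, 'm) category_scheme \<Rightarrow> 'a \<Rightarrow> 'a \<Rightarrow> bool" where
  "is_inverse C f g \<longleftrightarrow>
     f \<in> Arr C \<and> g \<in> hom C (Cod C f) (Dom C f) \<and>
     g \<cdot>\<^bsub>C\<^esub> f = Ident C (Dom C f) \<and> f \<cdot>\<^bsub>C\<^esub> g = Ident C (Cod C f)"

definition is_iso :: "('o, 'a, 'm) category_scheme \<Rightarrow> 'a \<Rightarrow> bool" where
  "is_iso C f \<longleftrightarrow> (\<exists>g. is_inverse C f g)"

definition inverse_arr :: "('o, 'a, 'm) category_scheme \<Rightarrow> 'a \<Rightarrow> 'a" where
  "inverse_arr C f = (THE g. is_inverse C f g)"


section \<open>Closed symmetric monoidal categories\<close>

record ('o, 'a) monoidal_category = "('o, 'a) category" +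
  tensor :: "'o \<Rightarrow> 'o \<Rightarrow> 'o" (infixr \<open>\<otimes>\<index>\<close> 70)
  tensor_arr :: "'a \<Rightarrow> 'a \<Rightarrow> 'a" (infixr \<open>\<boxtimes>\<index>\<close> 70)
  unit_obj :: "'o" (\<open>\<one>\<index>\<close>)
  assoc :: "'o \<Rightarrow> 'o \<Rightarrow> 'o \<Rightarrow> 'a"
  lunit :: "'o \<Rightarrow> 'a"
  runit :: "'o \<Rightarrow> 'a"

locale monoidal_category = category C
  for C :: "('o, 'a, 'm) monoidal_category_scheme" (structure) +
  assumes unit_obj_closed: "\<one> \<in> Obj C"
    and tensor_closed: "\<lbrakk>x \<in> Obj C; y \<in> Obj C\<rbrakk> \<Longrightarrow> x \<otimes> y \<in> Obj C"
    and tensor_hom: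
      "\<lbrakk>f \<in> hom C x x'; g \<in> hom C y y'\<rbrakk> \<Longrightarrow> f \<boxtimes> g \<in> hom C (x \<otimes> y) (x' \<otimes> y')"
    and tensor_Id: "\<lbrakk>x \<in> Obj C; y \<in> Obj C\<rbrakk> \<Longrightarrow> Ident C x \<boxtimes> Ident C y = Ident C (x \<otimes> y)"
    and tensor_Comp:
      "\<lbrakk>f \<in> hom C x x'; f' \<in> hom C x' x''; g \<in> hom C y y'; g' \<in> hom C y' y''\<rbrakk>
       \<Longrightarrow> (f' \<cdot> f) \<boxtimes> (g' \<cdot> g) = (f' \<boxtimes> g') \<cdot> (f \<boxtimes> g)"
    and assoc_hom:
      "\<lbrakk>x \<in> Obj C; y \<in> Obj C; z \<in> Obj C\<rbrakk>
       \<Longrightarrow> assoc C x y z \<in> hom C ((x \<otimes> y) \<otimes> z) (x \<otimes> (y \<otimes> z))"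
    and assoc_iso: "\<lbrakk>x \<in> Obj C; y \<in> Obj C; z \<in> Obj C\<rbrakk> \<Longrightarrow> is_iso C (assoc C x y z)"
    and assoc_natural:
      "\<lbrakk>f \<in> hom C x x'; g \<in> hom C y y'; h \<in> hom C z z'\<rbrakk>
       \<Longrightarrow> assoc C x' y' z' \<cdot> ((f \<boxtimes> g) \<boxtimes> h) = (f \<boxtimes> (g \<boxtimes> h)) \<cdot> assoc C x y z"
    and lunit_hom: "x \<in> Obj C \<Longrightarrow> lunit C x \<in> hom C (\<one> \<otimes> x) x"
    and lunit_iso: "x \<in> Obj C \<Longrightarrow> is_iso C (lunit C x)"
    and lunit_natural: "f \<in> hom C x y \<Longrightarrow> lunit C y \<cdot> (Ident C \<one> \<boxtimes> f) = f \<cdot> lunit C x"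
    and runit_hom: "x \<in> Obj C \<Longrightarrow> runit C x \<in> hom C (x \<otimes> \<one>) x"
    and runit_iso: "x \<in> Obj C \<Longrightarrow> is_iso C (runit C x)"
    and runit_natural: "f \<in> hom C x y \<Longrightarrow> runit C y \<cdot> (f \<boxtimes> Ident C \<one>) = f \<cdot> runit C x"
    and pentagon:
      "\<lbrakk>w \<in> Obj C; x \<in> Obj C; y \<in> Obj C; z \<in> Obj C\<rbrakk>
       \<Longrightarrow> assoc C w x (y \<otimes> z) \<cdot> assoc C (w \<otimes> x) y z =
           (Ident C w \<boxtimes> assoc C x y z) \<cdot> assoc C w (x \<otimes> y) z \<cdot> (assoc C w x y \<boxtimes> Ident C z)"
    and triangle:
      "\<lbrakk>x \<in> Obj C; y \<in> Obj C\<rbrakk>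
       \<Longrightarrow> (Ident C x \<boxtimes> lunit C y) \<cdot> assoc C x \<one> y = runit C x \<boxtimes> Ident C y"

record ('o, 'a) symmetric_monoidal_category = "('o, 'a) monoidal_category" +
  swap :: "'o \<Rightarrow> 'o \<Rightarrow> 'a"

locale symmetric_monoidal_category = monoidal_category C
  for C :: "('o, 'a, 'm) symmetric_monoidal_category_scheme" (structure) +
  assumes swap_hom: "\<lbrakk>x \<in> Obj C; y \<in> Obj C\<rbrakk> \<Longrightarrow> swap C x y \<in> hom C (x \<otimes> y) (y \<otimes> x)"
    and swap_natural:
      "\<lbrakk>f \<in> hom C x x'; g \<in> hom C y y'\<rbrakk> \<Longrightarrow> swap C x' y' \<cdot> (f \<boxtimes> g) = (g \<boxtimes> f) \<cdot> swap C x y"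
    and swap_swap: "\<lbrakk>x \<in> Obj C; y \<in> Obj C\<rbrakk> \<Longrightarrow> swap C y x \<cdot> swap C x y = Ident C (x \<otimes> y)"
    and hexagon:
      "\<lbrakk>x \<in> Obj C; y \<in> Obj C; z \<in> Obj C\<rbrakk>
       \<Longrightarrow> assoc C y z x \<cdot> swap C x (y \<otimes> z) \<cdot> assoc C x y z =
           (Ident C y \<boxtimes> swap C x z) \<cdot> assoc C y x z \<cdot> (swap C x y \<boxtimes> Ident C z)"

text \<open>
  \<open>ihom C y z\<close> is the internal hom \<open>[y;z]\<close>, right adjoint to tensoring with \<open>y\<close> \<^emph>\<open>on the left\<close>,
  with evaluation \<open>eval C y z : y \<otimes> [y;z] \<rightarrow> z\<close>.
\<close>

record ('o, 'a) closed_symmetric_monoidal_category = "('o, 'a) symmetric_monoidal_category" +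
  ihom :: "'o \<Rightarrow> 'o \<Rightarrow> 'o"
  eval :: "'o \<Rightarrow> 'o \<Rightarrow> 'a"

definition uncurry_left ::
    "('o, 'a, 'm) closed_symmetric_monoidal_category_scheme \<Rightarrow> 'o \<Rightarrow> 'o \<Rightarrow> 'a \<Rightarrow> 'a" where
  "uncurry_left C y z g = eval C y z \<cdot>\<^bsub>C\<^esub> (Ident C y \<boxtimes>\<^bsub>C\<^esub> g)"

locale closed_symmetric_monoidal_category = symmetric_monoidal_category C
  for C :: "('o, 'a, 'm) closed_symmetric_monoidal_category_scheme" (structure) +
  assumes ihom_closed: "\<lbrakk>y \<in> Obj C; z \<in> Obj C\<rbrakk> \<Longrightarrow> ihom C y z \<in> Obj C"
    and eval_hom: "\<lbrakk>y \<in> Obj C; z \<in> Obj C\<rbrakk> \<Longrightarrow> eval C y z \<in> hom C (y \<otimes> ihom C y z) z"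
    and uncurry_bij:
      "\<lbrakk>x \<in> Obj C; y \<in> Obj C; z \<in> Obj C\<rbrakk>
       \<Longrightarrow> bij_betw (uncurry_left C y z) (hom C x (ihom C y z)) (hom C (y \<otimes> x) z)"

text \<open>The adjoint \<open>x \<rightarrow> [y;z]\<close> of \<open>f : y \<otimes> x \<rightarrow> z\<close> with respect to the left factor \<open>y\<close>.\<close>

definition curry_left ::
    "('o, 'a, 'm) closed_symmetric_monoidal_category_scheme \<Rightarrow> 'o \<Rightarrow> 'o \<Rightarrow> 'o \<Rightarrow> 'a \<Rightarrow> 'a" where
  "curry_left C y x z f = inv_into (hom C x (ihom C y z)) (uncurry_left C y z) f"


section \<open>Self-enrichment\<close>

definition internal_id ::
    "('o, 'a, 'm) closed_symmetric_monoidal_category_scheme \<Rightarrow> 'o \<Rightarrow> 'a" where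
  "internal_id C x = curry_left C x \<one>\<^bsub>C\<^esub> x (runit C x)"

text \<open>
  Internal composition \<open>[y;z] \<otimes> [x;y] \<rightarrow> [x;z]\<close>, in the applicative order "\<open>(g, f) \<mapsto> g \<circ> f\<close>" of
  enriched category theory. As evaluation takes its argument on the left, it is the adjoint of
  \<open>x \<otimes> ([y;z] \<otimes> [x;y]) \<rightarrow> x \<otimes> ([x;y] \<otimes> [y;z]) \<rightarrow> (x \<otimes> [x;y]) \<otimes> [y;z] \<rightarrow> y \<otimes> [y;z] \<rightarrow> z\<close>.
\<close>

definition internal_comp ::
    "('o, 'a, 'm) closed_symmetric_monoidal_category_scheme \<Rightarrow> 'o \<Rightarrow> 'o \<Rightarrow> 'o \<Rightarrow> 'a" where
  "internal_comp C x y z =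
     (let G = ihom C y z; F = ihom C x y in
      curry_left C x (G \<otimes>\<^bsub>C\<^esub> F) z
        (eval C y z \<cdot>\<^bsub>C\<^esub>
         (eval C x y \<boxtimes>\<^bsub>C\<^esub> Ident C G) \<cdot>\<^bsub>C\<^esub>
         inverse_arr C (assoc C x F G) \<cdot>\<^bsub>C\<^esub>
         (Ident C x \<boxtimes>\<^bsub>C\<^esub> swap C G F)))"


section \<open>One-object enriched categories and enriched functors on them\<close>

definition one_object_enriched_category ::
    "('o, 'a, 'm) monoidal_category_scheme \<Rightarrow> 'o \<Rightarrow> 'a \<Rightarrow> 'a \<Rightarrow> bool" where
  "one_object_enriched_category C T \<mu> \<iota> \<longleftrightarrow>
     T \<in> Obj C \<and> \<mu> \<in> hom C (T \<otimes>\<^bsub>C\<^esub> T) T \<and> \<iota> \<in> hom C \<one>\<^bsub>C\<^esub> T \<and>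
     \<mu> \<cdot>\<^bsub>C\<^esub> (\<mu> \<boxtimes>\<^bsub>C\<^esub> Ident C T) = \<mu> \<cdot>\<^bsub>C\<^esub> (Ident C T \<boxtimes>\<^bsub>C\<^esub> \<mu>) \<cdot>\<^bsub>C\<^esub> assoc C T T T \<and>
     \<mu> \<cdot>\<^bsub>C\<^esub> (\<iota> \<boxtimes>\<^bsub>C\<^esub> Ident C T) = lunit C T \<and>
     \<mu> \<cdot>\<^bsub>C\<^esub> (Ident C T \<boxtimes>\<^bsub>C\<^esub> \<iota>) = runit C T"

text \<open>
  An enriched functor from the one-object enriched category \<open>(T, \<mu>, \<iota>)\<close> to \<open>C\<close>: the image \<open>X\<close> of
  the unique object (the domain of the functor) and the morphism \<open>\<Psi> : T \<rightarrow> [X;X]\<close> on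
  hom-objects (its parametric form).
\<close>

definition enriched_functor ::
    "('o, 'a, 'm) closed_symmetric_monoidal_category_scheme \<Rightarrow> 'o \<Rightarrow> 'a \<Rightarrow> 'a \<Rightarrow> 'o \<Rightarrow> 'a \<Rightarrow> bool"
    where
  "enriched_functor C T \<mu> \<iota> X \<Psi> \<longleftrightarrow>
     X \<in> Obj C \<and> \<Psi> \<in> hom C T (ihom C X X) \<and>
     \<Psi> \<cdot>\<^bsub>C\<^esub> \<iota> = internal_id C X \<and>
     \<Psi> \<cdot>\<^bsub>C\<^esub> \<mu> = internal_comp C X X X \<cdot>\<^bsub>C\<^esub> (\<Psi> \<boxtimes>\<^bsub>C\<^esub> \<Psi>)"

text \<open>
  The adjoint \<open>T \<otimes> X \<rightarrow> X\<close> of \<open>\<Psi> : T \<rightarrow> [X;X]\<close>. The internal-hom adjunction yields a morphism on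
  \<open>X \<otimes> T\<close>; the symmetry moves \<open>T\<close> to the left.
\<close>

definition flow_form ::
    "('o, 'a, 'm) closed_symmetric_monoidal_category_scheme \<Rightarrow> 'o \<Rightarrow> 'o \<Rightarrow> 'a \<Rightarrow> 'a" where
  "flow_form C T X \<Psi> = uncurry_left C X X \<Psi> \<cdot>\<^bsub>C\<^esub> swap C T X"

text \<open>
  The transfer operator, for \<open>\<Phi> : T \<otimes> \<Omega> \<rightarrow> \<Omega>\<close>. On elements, \<open>(s, \<gamma>) \<mapsto> (t \<mapsto> \<Phi>(s, \<gamma>(t)))\<close>; the
  factor that is curried away is the outer \<open>T\<close> of \<open>T \<otimes> (T \<otimes> [T;\<Omega>])\<close>.
\<close>

definition transfer_operator ::
    "('o, 'a, 'm) closed_symmetric_monoidal_category_scheme \<Rightarrow> 'o \<Rightarrow> 'o \<Rightarrow> 'a \<Rightarrow> 'a" where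
  "transfer_operator C T \<Omega> \<Phi> =
     (let P = ihom C T \<Omega> in
      curry_left C T (T \<otimes>\<^bsub>C\<^esub> P) \<Omega>
        (\<Phi> \<cdot>\<^bsub>C\<^esub>
         (Ident C T \<boxtimes>\<^bsub>C\<^esub> eval C T \<Omega>) \<cdot>\<^bsub>C\<^esub>
         assoc C T T P \<cdot>\<^bsub>C\<^esub>
         (swap C T T \<boxtimes>\<^bsub>C\<^esub> Ident C P) \<cdot>\<^bsub>C\<^esub>
         inverse_arr C (assoc C T T P)))"

end

theory Submission
  imports Defs
begin

text \<open>
  Under the internal-hom adjunction and the symmetry, a morphism \<open>\<Psi> : T \<rightarrow> [X;X]\<close> corresponds to
  \<open>a : T \<otimes> X \<rightarrow> X\<close>, and the functor laws of \<open>\<Psi>\<close> correspond to the left action laws of \<open>a\<close>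
  (\<open>enriched_functor_iff_left_action\<close>). This turns the hypothesis into: \<open>\<Phi>\<close> is a left action on
  \<open>\<Omega>\<close>; and it reduces the whole conclusion to: the transfer operator is a left action on
  \<open>[T;\<Omega>]\<close>, since every morphism \<open>T \<otimes> X \<rightarrow> X\<close> is the flow form of some \<open>\<Psi>\<close>.

  On elements the transfer operator sends \<open>(s, \<gamma>)\<close> to \<open>t \<mapsto> \<Phi>(s, \<gamma>(t))\<close>, so that evaluating an
  action law for it at \<open>t\<close> gives the same law for \<open>\<Phi>\<close> at \<open>\<gamma>(t)\<close>
  (\<open>left_action_transfer_operator\<close>). In the category, evaluation is injectivity of uncurrying, and
  what remains besides naturality is to move \<open>t\<close> past the other factors. Write
  \<open>\<sigma> : x \<otimes> (y \<otimes> z) \<rightarrow> y \<otimes> (x \<otimes> z)\<close> for the exchange of the first two factors. The unit law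
  needs that \<open>\<sigma>\<close> is compatible with the left unit constraint (\<open>lunit_exchange\<close>), and the
  composition law that exchanging \<open>x\<close> with \<open>y \<otimes> z\<close> is exchanging it with \<open>y\<close> and then with \<open>z\<close>
  (\<open>exchange_assoc\<close>). These rest on the pentagon, the hexagon, and two classical consequences of
  the axioms: the second unit triangle (\<open>lunit_tensor\<close>) and the compatibility of the symmetry with
  the unit constraints (\<open>lunit_swap\<close>).
\<close>

section \<open>Typed composites and invertible arrows\<close>

context category
begin

text \<open>Membership in hom-sets is resolved into equations for domains and codomains, so that the
  simplifier can discharge the typing conditions of the categorical laws.\<close>

lemma hom_iff: "f \<in> hom C x y \<longleftrightarrow> f \<in> Arr C \<and> Dom C f = x \<and> Cod C f = y"
  by (auto simp: hom_def)

lemma Dom_Obj [simp]: "f \<in> Arr C \<Longrightarrow> Dom C f \<in> Obj C"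
  and Cod_Obj [simp]: "f \<in> Arr C \<Longrightarrow> Cod C f \<in> Obj C"
  by (auto simp: Dom_closed Cod_closed)

lemma Ident_type [simp]:
  assumes "x \<in> Obj C"
  shows "Ident C x \<in> Arr C" "Dom C (Ident C x) = x" "Cod C (Ident C x) = x"
  using Id_hom[OF assms] by (auto simp: hom_iff)

lemma Comp_type [simp]:
  assumes "f \<in> Arr C" "g \<in> Arr C" "Dom C g = Cod C f"
  shows "g \<cdot> f \<in> Arr C" "Dom C (g \<cdot> f) = Dom C f" "Cod C (g \<cdot> f) = Cod C g"
  using Comp_hom[of f "Dom C f" "Cod C f" g "Cod C g"] assms by (auto simp: hom_iff)

lemma Comp_Ident [simp]: "\<lbrakk>f \<in> Arr C; Dom C f = x\<rbrakk> \<Longrightarrow> f \<cdot> Ident C x = f"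
  by (rule Comp_Id) (auto simp: hom_iff)

lemma Ident_Comp [simp]: "\<lbrakk>f \<in> Arr C; Cod C f = x\<rbrakk> \<Longrightarrow> Ident C x \<cdot> f = f"
  by (rule Id_Comp) (auto simp: hom_iff)

lemma Comp_assoc_right [simp]:
  "\<lbrakk>f \<in> Arr C; g \<in> Arr C; h \<in> Arr C; Dom C g = Cod C f; Dom C h = Cod C g\<rbrakk>
   \<Longrightarrow> (h \<cdot> g) \<cdot> f = h \<cdot> g \<cdot> f"
  by (rule Comp_assoc) (auto simp: hom_iff)

text \<open>Composites are kept bracketed to the right; this is how an equation between binary
  composites is applied in front of a further factor \<open>k\<close>.\<close>

lemma Comp_eq_tail:
  assumes "g \<cdot> f = r"
    and "f \<in> Arr C" "g \<in> Arr C" "k \<in> Arr C" "Dom C g = Cod C f" "Dom C f = Cod C k"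
  shows "g \<cdot> f \<cdot> k = r \<cdot> k"
  using Comp_assoc_right[of k f g] assms by simp

lemma inverse_unique:
  assumes "is_inverse C f g" "is_inverse C f h"
  shows "g = h"
proof -
  have "g = g \<cdot> (f \<cdot> h)"
    using assms by (auto simp: is_inverse_def hom_iff)
  also have "\<dots> = (g \<cdot> f) \<cdot> h"
    using assms by (subst Comp_assoc_right) (auto simp: is_inverse_def hom_iff)
  also have "\<dots> = h"
    using assms by (auto simp: is_inverse_def hom_iff)
  finally show ?thesis .
qed

lemma is_inverse_inverse_arr: "is_iso C f \<Longrightarrow> is_inverse C f (inverse_arr C f)"
  unfolding is_iso_def inverse_arr_def by (metis inverse_unique theI)

lemma iso_Arr: "is_iso C f \<Longrightarrow> f \<in> Arr C"
  by (auto simp: is_iso_def is_inverse_def)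

lemma inverse_arr_type [simp]:
  assumes "is_iso C f"
  shows "inverse_arr C f \<in> Arr C"
    "Dom C (inverse_arr C f) = Cod C f" "Cod C (inverse_arr C f) = Dom C f"
  using is_inverse_inverse_arr[OF assms] by (auto simp: is_inverse_def hom_iff)

lemma inverse_arr_cancel [simp]:
  assumes "is_iso C f"
  shows "inverse_arr C f \<cdot> f = Ident C (Dom C f)" "f \<cdot> inverse_arr C f = Ident C (Cod C f)"
  using is_inverse_inverse_arr[OF assms] by (auto simp: is_inverse_def)

lemma inverse_arr_cancel_tail [simp]:
  assumes "is_iso C f" "k \<in> Arr C"
  shows "Cod C k = Dom C f \<Longrightarrow> inverse_arr C f \<cdot> f \<cdot> k = k"
    "Cod C k = Cod C f \<Longrightarrow> f \<cdot> inverse_arr C f \<cdot> k = k"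
  using assms iso_Arr[OF assms(1)]
  by (simp_all add: Comp_eq_tail[OF inverse_arr_cancel(1)] Comp_eq_tail[OF inverse_arr_cancel(2)])

lemma is_isoI:
  assumes "f \<in> Arr C" "g \<in> Arr C" "Dom C g = Cod C f" "Cod C g = Dom C f"
    and "g \<cdot> f = Ident C (Dom C f)" "f \<cdot> g = Ident C (Cod C f)"
  shows "is_iso C f"
  using assms by (auto simp: is_iso_def is_inverse_def hom_iff)

lemma is_iso_Ident [simp]: "x \<in> Obj C \<Longrightarrow> is_iso C (Ident C x)"
  by (rule is_isoI[where g = "Ident C x"]) auto

lemma is_iso_Comp [simp]:
  assumes "is_iso C f" "is_iso C g" "Dom C g = Cod C f"
  shows "is_iso C (g \<cdot> f)"
  using assms iso_Arr[OF assms(1)] iso_Arr[OF assms(2)]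
  by (intro is_isoI[where g = "inverse_arr C f \<cdot> inverse_arr C g"]) auto

lemma iso_cancel_right:
  assumes "f \<cdot> e = g \<cdot> e" "is_iso C e"
    and "f \<in> Arr C" "g \<in> Arr C" "Dom C f = Cod C e" "Dom C g = Cod C e"
  shows "f = g"
proof -
  have "(f \<cdot> e) \<cdot> inverse_arr C e = (g \<cdot> e) \<cdot> inverse_arr C e"
    using assms(1) by simp
  then show ?thesis
    using assms(2-) iso_Arr[OF assms(2)] by simp
qed

lemma iso_cancel_left:
  assumes "e \<cdot> f = e \<cdot> g" "is_iso C e"
    and "f \<in> Arr C" "g \<in> Arr C" "Cod C f = Dom C e" "Cod C g = Dom C e"
  shows "f = g"
proof -
  have "inverse_arr C e \<cdot> e \<cdot> f = inverse_arr C e \<cdot> e \<cdot> g"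
    using assms(1) by simp
  then show ?thesis
    using assms(2-) by simp
qed

end


section \<open>Coherence in monoidal categories\<close>

context monoidal_category
begin

lemma unit_Obj [simp]: "\<one> \<in> Obj C"
  by (rule unit_obj_closed)

lemma tensor_Obj [simp]: "\<lbrakk>x \<in> Obj C; y \<in> Obj C\<rbrakk> \<Longrightarrow> x \<otimes> y \<in> Obj C"
  by (rule tensor_closed)

lemma tensor_type [simp]:
  assumes "f \<in> Arr C" "g \<in> Arr C"
  shows "f \<boxtimes> g \<in> Arr C" "Dom C (f \<boxtimes> g) = Dom C f \<otimes> Dom C g"
    "Cod C (f \<boxtimes> g) = Cod C f \<otimes> Cod C g"
  using tensor_hom[of f "Dom C f" "Cod C f" g "Dom C g" "Cod C g"] assms
  by (auto simp: hom_iff)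

lemma assoc_type [simp]:
  assumes "x \<in> Obj C" "y \<in> Obj C" "z \<in> Obj C"
  shows "assoc C x y z \<in> Arr C" "Dom C (assoc C x y z) = (x \<otimes> y) \<otimes> z"
    "Cod C (assoc C x y z) = x \<otimes> y \<otimes> z" "is_iso C (assoc C x y z)"
  using assoc_hom[OF assms] assoc_iso[OF assms] by (auto simp: hom_iff)

lemma lunit_type [simp]:
  assumes "x \<in> Obj C"
  shows "lunit C x \<in> Arr C" "Dom C (lunit C x) = \<one> \<otimes> x" "Cod C (lunit C x) = x"
    "is_iso C (lunit C x)"
  using lunit_hom[OF assms] lunit_iso[OF assms] by (auto simp: hom_iff)

lemma runit_type [simp]:
  assumes "x \<in> Obj C"
  shows "runit C x \<in> Arr C" "Dom C (runit C x) = x \<otimes> \<one>" "Cod C (runit C x) = x"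
    "is_iso C (runit C x)"
  using runit_hom[OF assms] runit_iso[OF assms] by (auto simp: hom_iff)

lemma interchange:
  assumes "f \<in> Arr C" "f' \<in> Arr C" "g \<in> Arr C" "g' \<in> Arr C"
    and "Dom C f' = Cod C f" "Dom C g' = Cod C g"
  shows "(f' \<boxtimes> g') \<cdot> (f \<boxtimes> g) = (f' \<cdot> f) \<boxtimes> (g' \<cdot> g)"
  by (rule tensor_Comp[symmetric]) (use assms in \<open>auto simp: hom_iff\<close>)

lemma interchange_tail:
  assumes "f \<in> Arr C" "f' \<in> Arr C" "g \<in> Arr C" "g' \<in> Arr C"
    and "Dom C f' = Cod C f" "Dom C g' = Cod C g"
    and "k \<in> Arr C" "Cod C k = Dom C f \<otimes> Dom C g"
  shows "(f' \<boxtimes> g') \<cdot> (f \<boxtimes> g) \<cdot> k = ((f' \<cdot> f) \<boxtimes> (g' \<cdot> g)) \<cdot> k"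
  by (rule Comp_eq_tail[OF interchange]) (use assms in auto)

lemma is_iso_tensor [simp]:
  assumes "is_iso C f" "is_iso C g"
  shows "is_iso C (f \<boxtimes> g)"
  using assms iso_Arr[OF assms(1)] iso_Arr[OF assms(2)]
  by (intro is_isoI[where g = "inverse_arr C f \<boxtimes> inverse_arr C g"])
     (auto simp: interchange tensor_Id)

lemma assoc_nat:
  assumes "f \<in> Arr C" "g \<in> Arr C" "h \<in> Arr C" "Cod C f = x" "Cod C g = y" "Cod C h = z"
  shows "assoc C x y z \<cdot> ((f \<boxtimes> g) \<boxtimes> h) =
    (f \<boxtimes> g \<boxtimes> h) \<cdot> assoc C (Dom C f) (Dom C g) (Dom C h)"
  by (rule assoc_natural) (use assms in \<open>auto simp: hom_iff\<close>)

lemma assoc_nat_tail: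
  assumes "f \<in> Arr C" "g \<in> Arr C" "h \<in> Arr C" "Cod C f = x" "Cod C g = y" "Cod C h = z"
    and "k \<in> Arr C" "Cod C k = (Dom C f \<otimes> Dom C g) \<otimes> Dom C h"
  shows "assoc C x y z \<cdot> ((f \<boxtimes> g) \<boxtimes> h) \<cdot> k =
    (f \<boxtimes> g \<boxtimes> h) \<cdot> assoc C (Dom C f) (Dom C g) (Dom C h) \<cdot> k"
  using Comp_eq_tail[OF assoc_nat[OF assms(1-6)], of k] assms by auto

lemma inverse_assoc_nat:
  assumes "f \<in> Arr C" "g \<in> Arr C" "h \<in> Arr C" "Cod C f = x" "Cod C g = y" "Cod C h = z"
  shows "inverse_arr C (assoc C x y z) \<cdot> (f \<boxtimes> g \<boxtimes> h) =
    ((f \<boxtimes> g) \<boxtimes> h) \<cdot> inverse_arr C (assoc C (Dom C f) (Dom C g) (Dom C h))"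
proof (rule iso_cancel_right)
  let ?a = "assoc C (Dom C f) (Dom C g) (Dom C h)"
  have "inverse_arr C (assoc C x y z) \<cdot> (f \<boxtimes> g \<boxtimes> h) \<cdot> ?a
      = inverse_arr C (assoc C x y z) \<cdot> assoc C x y z \<cdot> ((f \<boxtimes> g) \<boxtimes> h)"
    using assms by (subst assoc_nat) auto
  also have "\<dots> = (f \<boxtimes> g) \<boxtimes> h"
    using assms by auto
  finally show "(inverse_arr C (assoc C x y z) \<cdot> (f \<boxtimes> g \<boxtimes> h)) \<cdot> ?a
      = (((f \<boxtimes> g) \<boxtimes> h) \<cdot> inverse_arr C ?a) \<cdot> ?a"
    using assms by auto
qed (use assms in auto)

lemma lunit_nat:
  "\<lbrakk>f \<in> Arr C; Cod C f = y\<rbrakk> \<Longrightarrow> lunit C y \<cdot> (Ident C \<one> \<boxtimes> f) = f \<cdot> lunit C (Dom C f)"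
  by (rule lunit_natural) (auto simp: hom_iff)

lemma runit_nat:
  "\<lbrakk>f \<in> Arr C; Cod C f = y\<rbrakk> \<Longrightarrow> runit C y \<cdot> (f \<boxtimes> Ident C \<one>) = f \<cdot> runit C (Dom C f)"
  by (rule runit_natural) (auto simp: hom_iff)

lemma unit_tensor_faithful:
  assumes "Ident C \<one> \<boxtimes> f = Ident C \<one> \<boxtimes> g"
    and "f \<in> Arr C" "g \<in> Arr C" "Dom C f = Dom C g" "Cod C f = Cod C g"
  shows "f = g"
proof (rule iso_cancel_right)
  show "f \<cdot> lunit C (Dom C f) = g \<cdot> lunit C (Dom C f)"
    using lunit_nat[of f "Cod C f"] lunit_nat[of g "Cod C f"] assms by simp
qed (use assms in auto)

lemma tensor_unit_faithful:
  assumes "f \<boxtimes> Ident C \<one> = g \<boxtimes> Ident C \<one>"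
    and "f \<in> Arr C" "g \<in> Arr C" "Dom C f = Dom C g" "Cod C f = Cod C g"
  shows "f = g"
proof (rule iso_cancel_right)
  show "f \<cdot> runit C (Dom C f) = g \<cdot> runit C (Dom C f)"
    using runit_nat[of f "Cod C f"] runit_nat[of g "Cod C f"] assms by simp
qed (use assms in auto)

text \<open>Kelly's derivation of the second unit triangle from the pentagon and the first one: both
  sides are compared after tensoring with the unit object.\<close>

lemma lunit_tensor:
  assumes [simp]: "x \<in> Obj C" "y \<in> Obj C"
  shows "lunit C (x \<otimes> y) \<cdot> assoc C \<one> x y = lunit C x \<boxtimes> Ident C y"
proof (rule unit_tensor_faithful)
  let ?I = "Ident C \<one>"
  let ?e = "assoc C \<one> (\<one> \<otimes> x) y \<cdot> (assoc C \<one> \<one> x \<boxtimes> Ident C y)"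
  show "?I \<boxtimes> (lunit C (x \<otimes> y) \<cdot> assoc C \<one> x y) = ?I \<boxtimes> (lunit C x \<boxtimes> Ident C y)"
  proof (rule iso_cancel_right[where e = ?e])
    have "(?I \<boxtimes> (lunit C (x \<otimes> y) \<cdot> assoc C \<one> x y)) \<cdot> ?e
        = (?I \<boxtimes> lunit C (x \<otimes> y)) \<cdot> (?I \<boxtimes> assoc C \<one> x y) \<cdot> ?e"
      by (simp add: interchange_tail)
    also have "\<dots> = (?I \<boxtimes> lunit C (x \<otimes> y)) \<cdot> assoc C \<one> \<one> (x \<otimes> y) \<cdot> assoc C (\<one> \<otimes> \<one>) x y"
      by (simp add: pentagon)
    also have "\<dots> = (runit C \<one> \<boxtimes> Ident C x \<boxtimes> Ident C y) \<cdot> assoc C (\<one> \<otimes> \<one>) x y"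
      by (simp add: Comp_eq_tail[OF triangle] tensor_Id)
    also have "\<dots> = assoc C \<one> x y \<cdot> ((runit C \<one> \<boxtimes> Ident C x) \<boxtimes> Ident C y)"
      by (simp add: assoc_nat)
    also have "\<dots> = assoc C \<one> x y \<cdot> ((?I \<boxtimes> lunit C x) \<boxtimes> Ident C y)
        \<cdot> (assoc C \<one> \<one> x \<boxtimes> Ident C y)"
      by (simp add: interchange triangle)
    also have "\<dots> = (?I \<boxtimes> (lunit C x \<boxtimes> Ident C y)) \<cdot> ?e"
      by (simp add: assoc_nat_tail)
    finally show "(?I \<boxtimes> (lunit C (x \<otimes> y) \<cdot> assoc C \<one> x y)) \<cdot> ?e
        = (?I \<boxtimes> (lunit C x \<boxtimes> Ident C y)) \<cdot> ?e" .
  qed simp_all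
qed simp_all

end


section \<open>Coherence of the symmetry\<close>

context symmetric_monoidal_category
begin

lemma swap_type [simp]:
  assumes "x \<in> Obj C" "y \<in> Obj C"
  shows "swap C x y \<in> Arr C" "Dom C (swap C x y) = x \<otimes> y" "Cod C (swap C x y) = y \<otimes> x"
  using swap_hom[OF assms] by (auto simp: hom_iff)

lemma swap_cancel [simp]:
  "\<lbrakk>x \<in> Obj C; y \<in> Obj C\<rbrakk> \<Longrightarrow> swap C y x \<cdot> swap C x y = Ident C (x \<otimes> y)"
  by (rule swap_swap)

lemma swap_cancel_tail [simp]:
  "\<lbrakk>x \<in> Obj C; y \<in> Obj C; k \<in> Arr C; Cod C k = x \<otimes> y\<rbrakk> \<Longrightarrow> swap C y x \<cdot> swap C x y \<cdot> k = k"
  by (simp add: Comp_eq_tail[OF swap_swap])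

lemma is_iso_swap [simp]: "\<lbrakk>x \<in> Obj C; y \<in> Obj C\<rbrakk> \<Longrightarrow> is_iso C (swap C x y)"
  by (rule is_isoI[where g = "swap C y x"]) auto

lemma swap_nat:
  "\<lbrakk>f \<in> Arr C; g \<in> Arr C; Cod C f = x; Cod C g = y\<rbrakk>
   \<Longrightarrow> swap C x y \<cdot> (f \<boxtimes> g) = (g \<boxtimes> f) \<cdot> swap C (Dom C f) (Dom C g)"
  by (rule swap_natural) (auto simp: hom_iff)

lemma swap_nat_tail:
  assumes "f \<in> Arr C" "g \<in> Arr C" "Cod C f = x" "Cod C g = y"
    and "k \<in> Arr C" "Cod C k = Dom C f \<otimes> Dom C g"
  shows "swap C x y \<cdot> (f \<boxtimes> g) \<cdot> k = (g \<boxtimes> f) \<cdot> swap C (Dom C f) (Dom C g) \<cdot> k"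
  using Comp_eq_tail[OF swap_nat[OF assms(1-4)], of k] assms by auto

text \<open>Composing the hexagon for \<open>x, \<one>, \<one>\<close> with a left unit constraint leaves this identity
  tensored with \<open>\<one>\<close>.\<close>

lemma lunit_swap:
  assumes [simp]: "x \<in> Obj C"
  shows "lunit C x \<cdot> swap C x \<one> = runit C x"
proof (rule tensor_unit_faithful)
  let ?I = "Ident C \<one>"
  show "(lunit C x \<cdot> swap C x \<one>) \<boxtimes> ?I = runit C x \<boxtimes> ?I"
  proof (rule iso_cancel_left[where e = "swap C x \<one>"])
    have "swap C x \<one> \<cdot> ((lunit C x \<cdot> swap C x \<one>) \<boxtimes> ?I)
        = swap C x \<one> \<cdot> (lunit C x \<boxtimes> ?I) \<cdot> (swap C x \<one> \<boxtimes> ?I)"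
      by (simp add: interchange)
    also have "\<dots> = swap C x \<one> \<cdot> lunit C (x \<otimes> \<one>) \<cdot> assoc C \<one> x \<one> \<cdot> (swap C x \<one> \<boxtimes> ?I)"
      by (simp add: lunit_tensor[symmetric])
    also have "\<dots> = lunit C (\<one> \<otimes> x) \<cdot> (?I \<boxtimes> swap C x \<one>) \<cdot> assoc C \<one> x \<one> \<cdot> (swap C x \<one> \<boxtimes> ?I)"
      by (simp add: Comp_eq_tail[OF lunit_nat])
    also have "\<dots> = lunit C (\<one> \<otimes> x) \<cdot> assoc C \<one> \<one> x \<cdot> swap C x (\<one> \<otimes> \<one>) \<cdot> assoc C x \<one> \<one>"
      by (simp add: hexagon)
    also have "\<dots> = (lunit C \<one> \<boxtimes> Ident C x) \<cdot> swap C x (\<one> \<otimes> \<one>) \<cdot> assoc C x \<one> \<one>"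
      by (simp add: Comp_eq_tail[OF lunit_tensor])
    also have "\<dots> = swap C x \<one> \<cdot> (Ident C x \<boxtimes> lunit C \<one>) \<cdot> assoc C x \<one> \<one>"
      by (simp add: swap_nat_tail)
    also have "\<dots> = swap C x \<one> \<cdot> (runit C x \<boxtimes> ?I)"
      by (simp add: triangle)
    finally show "swap C x \<one> \<cdot> ((lunit C x \<cdot> swap C x \<one>) \<boxtimes> ?I)
        = swap C x \<one> \<cdot> (runit C x \<boxtimes> ?I)" .
  qed simp_all
qed simp_all

text \<open>The hexagon moves one factor past two; inverting every arrow in it moves two factors past
  one.\<close>

lemma hexagon_inverse:
  assumes [simp]: "x \<in> Obj C" "y \<in> Obj C" "z \<in> Obj C"
  shows "swap C (x \<otimes> y) z \<cdot> inverse_arr C (assoc C x y z) \<cdot> (Ident C x \<boxtimes> swap C z y)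
      \<cdot> assoc C x z y = assoc C z x y \<cdot> (swap C x z \<boxtimes> Ident C y)"
proof (rule iso_cancel_right[where e = "swap C z x \<boxtimes> Ident C y"])
  have "swap C (x \<otimes> y) z \<cdot> inverse_arr C (assoc C x y z) \<cdot> (Ident C x \<boxtimes> swap C z y)
      \<cdot> assoc C x z y \<cdot> (swap C z x \<boxtimes> Ident C y)
    = swap C (x \<otimes> y) z \<cdot> inverse_arr C (assoc C x y z) \<cdot> assoc C x y z
      \<cdot> swap C z (x \<otimes> y) \<cdot> assoc C z x y"
    by (simp only: hexagon assms)
  also have "\<dots> = assoc C z x y"
    by simp
  also have "\<dots> = assoc C z x y \<cdot> (swap C x z \<boxtimes> Ident C y) \<cdot> (swap C z x \<boxtimes> Ident C y)"
    by (simp add: interchange tensor_Id)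
  finally show "(swap C (x \<otimes> y) z \<cdot> inverse_arr C (assoc C x y z) \<cdot> (Ident C x \<boxtimes> swap C z y)
      \<cdot> assoc C x z y) \<cdot> (swap C z x \<boxtimes> Ident C y)
    = (assoc C z x y \<cdot> (swap C x z \<boxtimes> Ident C y)) \<cdot> (swap C z x \<boxtimes> Ident C y)"
    by simp
qed simp_all

text \<open>On elements, both sides send \<open>(x, (s, t))\<close> to \<open>(s, (t, x))\<close>.\<close>

lemma swap_two_factors:
  assumes [simp]: "x \<in> Obj C" "y \<in> Obj C" "z \<in> Obj C"
  shows "(Ident C y \<boxtimes> swap C x z) \<cdot> swap C (x \<otimes> z) y \<cdot> inverse_arr C (assoc C x z y)
      \<cdot> (Ident C x \<boxtimes> swap C y z) = assoc C y z x \<cdot> swap C x (y \<otimes> z)"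
  by (rule iso_cancel_right[where e = "assoc C x y z"])
     (simp_all add: hexagon hexagon_inverse)

text \<open>The exchange of the first two of three factors, \<open>(s, (t, p)) \<mapsto> (t, (s, p))\<close>.\<close>

definition exchange :: "'o \<Rightarrow> 'o \<Rightarrow> 'o \<Rightarrow> 'a" where
  "exchange x y z =
     assoc C y x z \<cdot> (swap C x y \<boxtimes> Ident C z) \<cdot> inverse_arr C (assoc C x y z)"

lemma exchange_type [simp]:
  assumes "x \<in> Obj C" "y \<in> Obj C" "z \<in> Obj C"
  shows "exchange x y z \<in> Arr C" "Dom C (exchange x y z) = x \<otimes> y \<otimes> z"
    "Cod C (exchange x y z) = y \<otimes> x \<otimes> z"
  using assms by (simp_all add: exchange_def)

lemma exchange_nat:
  assumes "f \<in> Arr C" "g \<in> Arr C" "h \<in> Arr C" "Cod C f = x" "Cod C g = y" "Cod C h = z"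
  shows "exchange x y z \<cdot> (f \<boxtimes> g \<boxtimes> h)
    = (g \<boxtimes> f \<boxtimes> h) \<cdot> exchange (Dom C f) (Dom C g) (Dom C h)"
proof -
  have [simp]: "x \<in> Obj C" "y \<in> Obj C" "z \<in> Obj C"
    using assms by auto
  let ?i = "inverse_arr C (assoc C (Dom C f) (Dom C g) (Dom C h))"
  have "exchange x y z \<cdot> (f \<boxtimes> g \<boxtimes> h)
      = assoc C y x z \<cdot> (swap C x y \<boxtimes> Ident C z) \<cdot> ((f \<boxtimes> g) \<boxtimes> h) \<cdot> ?i"
    using assms by (simp add: exchange_def inverse_assoc_nat)
  also have "\<dots> = assoc C y x z \<cdot> ((g \<boxtimes> f) \<boxtimes> h)
      \<cdot> (swap C (Dom C f) (Dom C g) \<boxtimes> Ident C (Dom C h)) \<cdot> ?i"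
    using assms by (simp add: interchange_tail swap_nat)
  also have "\<dots> = (g \<boxtimes> f \<boxtimes> h) \<cdot> exchange (Dom C f) (Dom C g) (Dom C h)"
    using assms by (simp add: assoc_nat_tail exchange_def)
  finally show ?thesis .
qed

lemma exchange_nat_tail:
  assumes "f \<in> Arr C" "g \<in> Arr C" "h \<in> Arr C" "Cod C f = x" "Cod C g = y" "Cod C h = z"
    and "k \<in> Arr C" "Cod C k = Dom C f \<otimes> Dom C g \<otimes> Dom C h"
  shows "exchange x y z \<cdot> (f \<boxtimes> g \<boxtimes> h) \<cdot> k
    = (g \<boxtimes> f \<boxtimes> h) \<cdot> exchange (Dom C f) (Dom C g) (Dom C h) \<cdot> k"
  using Comp_eq_tail[OF exchange_nat[OF assms(1-6)], of k] assms by auto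

lemma lunit_exchange:
  assumes [simp]: "x \<in> Obj C" "y \<in> Obj C"
  shows "lunit C (x \<otimes> y) \<cdot> exchange x \<one> y = Ident C x \<boxtimes> lunit C y"
proof -
  have "lunit C (x \<otimes> y) \<cdot> exchange x \<one> y
      = (lunit C x \<boxtimes> Ident C y) \<cdot> (swap C x \<one> \<boxtimes> Ident C y) \<cdot> inverse_arr C (assoc C x \<one> y)"
    by (simp add: exchange_def Comp_eq_tail[OF lunit_tensor])
  also have "\<dots> = (runit C x \<boxtimes> Ident C y) \<cdot> inverse_arr C (assoc C x \<one> y)"
    by (simp add: interchange_tail lunit_swap)
  also have "\<dots> = Ident C x \<boxtimes> lunit C y"
    by (simp add: triangle[symmetric])
  finally show ?thesis .
qed

text \<open>Moving \<open>x\<close> past \<open>y\<close> and then past \<open>z\<close> is moving it past \<open>y \<otimes> z\<close>: the hexagon tensored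
  with \<open>w\<close>, with three pentagons to rebracket.\<close>

lemma exchange_assoc:
  assumes [simp]: "x \<in> Obj C" "y \<in> Obj C" "z \<in> Obj C" "w \<in> Obj C"
  shows "(Ident C y \<boxtimes> exchange x z w) \<cdot> exchange x y (z \<otimes> w) \<cdot> (Ident C x \<boxtimes> assoc C y z w)
    = assoc C y z (x \<otimes> w) \<cdot> exchange x (y \<otimes> z) w"
proof -
  let ?w = "Ident C w"
  let ?e = "assoc C x (y \<otimes> z) w \<cdot> (assoc C x y z \<boxtimes> ?w)"
  let ?m = "(Ident C y \<boxtimes> (assoc C z x w \<cdot> (swap C x z \<boxtimes> ?w)))
      \<cdot> assoc C y (x \<otimes> z) w \<cdot> (assoc C y x z \<boxtimes> ?w) \<cdot> ((swap C x y \<boxtimes> Ident C z) \<boxtimes> ?w)"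
  have "(Ident C y \<boxtimes> exchange x z w) \<cdot> exchange x y (z \<otimes> w) \<cdot> (Ident C x \<boxtimes> assoc C y z w) \<cdot> ?e
    = (Ident C y \<boxtimes> exchange x z w) \<cdot> exchange x y (z \<otimes> w)
      \<cdot> assoc C x y (z \<otimes> w) \<cdot> assoc C (x \<otimes> y) z w"
    by (simp add: pentagon)
  also have "\<dots> = (Ident C y \<boxtimes> exchange x z w) \<cdot> assoc C y x (z \<otimes> w)
      \<cdot> (swap C x y \<boxtimes> Ident C z \<boxtimes> ?w) \<cdot> assoc C (x \<otimes> y) z w"
    by (simp add: exchange_def[of x y] tensor_Id)
  also have "\<dots> = (Ident C y \<boxtimes> exchange x z w) \<cdot> assoc C y x (z \<otimes> w)
      \<cdot> assoc C (y \<otimes> x) z w \<cdot> ((swap C x y \<boxtimes> Ident C z) \<boxtimes> ?w)"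
    by (simp add: assoc_nat)
  also have "\<dots> = (Ident C y \<boxtimes> exchange x z w) \<cdot> (Ident C y \<boxtimes> assoc C x z w)
      \<cdot> assoc C y (x \<otimes> z) w \<cdot> (assoc C y x z \<boxtimes> ?w) \<cdot> ((swap C x y \<boxtimes> Ident C z) \<boxtimes> ?w)"
    by (simp add: Comp_eq_tail[OF pentagon])
  also have "\<dots> = ?m"
    by (simp add: interchange_tail exchange_def)
  finally have l: "(Ident C y \<boxtimes> exchange x z w) \<cdot> exchange x y (z \<otimes> w)
      \<cdot> (Ident C x \<boxtimes> assoc C y z w) \<cdot> ?e = ?m" .
  have "assoc C y z (x \<otimes> w) \<cdot> exchange x (y \<otimes> z) w \<cdot> ?e
    = assoc C y z (x \<otimes> w) \<cdot> assoc C (y \<otimes> z) x w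
      \<cdot> (swap C x (y \<otimes> z) \<boxtimes> ?w) \<cdot> (assoc C x y z \<boxtimes> ?w)"
    by (simp add: exchange_def)
  also have "\<dots> = (Ident C y \<boxtimes> assoc C z x w) \<cdot> assoc C y (z \<otimes> x) w
      \<cdot> (assoc C y z x \<boxtimes> ?w) \<cdot> (swap C x (y \<otimes> z) \<boxtimes> ?w) \<cdot> (assoc C x y z \<boxtimes> ?w)"
    by (simp add: Comp_eq_tail[OF pentagon])
  also have "\<dots> = (Ident C y \<boxtimes> assoc C z x w) \<cdot> assoc C y (z \<otimes> x) w
      \<cdot> ((assoc C y z x \<cdot> swap C x (y \<otimes> z) \<cdot> assoc C x y z) \<boxtimes> ?w)"
    by (simp add: interchange)
  also have "\<dots> = (Ident C y \<boxtimes> assoc C z x w) \<cdot> assoc C y (z \<otimes> x) w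
      \<cdot> ((Ident C y \<boxtimes> swap C x z) \<boxtimes> ?w) \<cdot> (assoc C y x z \<boxtimes> ?w)
      \<cdot> ((swap C x y \<boxtimes> Ident C z) \<boxtimes> ?w)"
    by (simp add: hexagon interchange)
  also have "\<dots> = (Ident C y \<boxtimes> assoc C z x w) \<cdot> (Ident C y \<boxtimes> (swap C x z \<boxtimes> ?w))
      \<cdot> assoc C y (x \<otimes> z) w \<cdot> (assoc C y x z \<boxtimes> ?w) \<cdot> ((swap C x y \<boxtimes> Ident C z) \<boxtimes> ?w)"
    by (simp add: assoc_nat_tail)
  also have "\<dots> = ?m"
    by (simp add: interchange_tail)
  finally have r: "assoc C y z (x \<otimes> w) \<cdot> exchange x (y \<otimes> z) w \<cdot> ?e = ?m" .
  show ?thesis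
    by (rule iso_cancel_right[where e = ?e]) (use l r in simp_all)
qed

end


section \<open>Enriched functors as left actions\<close>

text \<open>The identities of a left action of \<open>(T, \<mu>, \<iota>)\<close> on \<open>X\<close>, for \<open>a : T \<otimes> X \<rightarrow> X\<close>. Only the two
  equations are recorded: typing and the monoid laws are kept apart.\<close>

definition left_action ::
    "('o, 'a, 'm) monoidal_category_scheme \<Rightarrow> 'o \<Rightarrow> 'a \<Rightarrow> 'a \<Rightarrow> 'o \<Rightarrow> 'a \<Rightarrow> bool" where
  "left_action C T \<mu> \<iota> X a \<longleftrightarrow>
     a \<cdot>\<^bsub>C\<^esub> (\<iota> \<boxtimes>\<^bsub>C\<^esub> Ident C X) = lunit C X \<and>
     a \<cdot>\<^bsub>C\<^esub> (Ident C T \<boxtimes>\<^bsub>C\<^esub> a) \<cdot>\<^bsub>C\<^esub> assoc C T T X = a \<cdot>\<^bsub>C\<^esub> (\<mu> \<boxtimes>\<^bsub>C\<^esub> Ident C X)"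

context closed_symmetric_monoidal_category
begin

lemma ihom_Obj [simp]: "\<lbrakk>y \<in> Obj C; z \<in> Obj C\<rbrakk> \<Longrightarrow> ihom C y z \<in> Obj C"
  by (rule ihom_closed)

lemma eval_type [simp]:
  assumes "y \<in> Obj C" "z \<in> Obj C"
  shows "eval C y z \<in> Arr C" "Dom C (eval C y z) = y \<otimes> ihom C y z" "Cod C (eval C y z) = z"
  using eval_hom[OF assms] by (auto simp: hom_iff)

lemma curry_left_type [simp]:
  assumes "f \<in> Arr C" "Dom C f = y \<otimes> x" "Cod C f = z" "x \<in> Obj C" "y \<in> Obj C"
  shows "curry_left C y x z f \<in> Arr C" "Dom C (curry_left C y x z f) = x"
    "Cod C (curry_left C y x z f) = ihom C y z"
proof -
  have z: "z \<in> Obj C" using assms by auto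
  have "curry_left C y x z f \<in> hom C x (ihom C y z)"
    unfolding curry_left_def
    by (rule inv_into_into)
       (use uncurry_bij[OF assms(4,5) z] assms in \<open>auto simp: bij_betw_def hom_iff\<close>)
  then show "curry_left C y x z f \<in> Arr C" "Dom C (curry_left C y x z f) = x"
    "Cod C (curry_left C y x z f) = ihom C y z"
    by (auto simp: hom_iff)
qed

lemma eval_curry_left:
  assumes "f \<in> Arr C" "Dom C f = y \<otimes> x" "Cod C f = z" "x \<in> Obj C" "y \<in> Obj C"
  shows "eval C y z \<cdot> (Ident C y \<boxtimes> curry_left C y x z f) = f"
proof -
  have z: "z \<in> Obj C" using assms by auto
  have "uncurry_left C y z (curry_left C y x z f) = f"
    unfolding curry_left_def
    by (rule bij_betw_inv_into_right[OF uncurry_bij[OF assms(4,5) z]])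
       (use assms in \<open>auto simp: hom_iff\<close>)
  then show ?thesis by (simp add: uncurry_left_def)
qed

lemma uncurry_left_inject:
  assumes "eval C y z \<cdot> (Ident C y \<boxtimes> f) = eval C y z \<cdot> (Ident C y \<boxtimes> g)"
    and "f \<in> Arr C" "g \<in> Arr C" "Dom C f = Dom C g"
    and "Cod C f = ihom C y z" "Cod C g = ihom C y z" "y \<in> Obj C" "z \<in> Obj C"
  shows "f = g"
  using uncurry_bij[of "Dom C f" y z] assms
  by (auto simp: bij_betw_def inj_on_def hom_iff uncurry_left_def)

lemma uncurry_internal_id:
  "x \<in> Obj C \<Longrightarrow> eval C x x \<cdot> (Ident C x \<boxtimes> internal_id C x) = runit C x"
  unfolding internal_id_def by (rule eval_curry_left) auto

lemma internal_id_type [simp]: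
  assumes "x \<in> Obj C"
  shows "internal_id C x \<in> Arr C" "Dom C (internal_id C x) = \<one>"
    "Cod C (internal_id C x) = ihom C x x"
  using assms by (simp_all add: internal_id_def)

lemma internal_comp_type [simp]:
  assumes "x \<in> Obj C" "y \<in> Obj C" "z \<in> Obj C"
  shows "internal_comp C x y z \<in> Arr C"
    "Dom C (internal_comp C x y z) = ihom C y z \<otimes> ihom C x y"
    "Cod C (internal_comp C x y z) = ihom C x z"
  using assms by (simp_all add: internal_comp_def Let_def)

lemma uncurry_internal_comp:
  assumes "x \<in> Obj C" "y \<in> Obj C" "z \<in> Obj C"
  shows "eval C x z \<cdot> (Ident C x \<boxtimes> internal_comp C x y z)
    = eval C y z \<cdot> (eval C x y \<boxtimes> Ident C (ihom C y z))
      \<cdot> inverse_arr C (assoc C x (ihom C x y) (ihom C y z))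
      \<cdot> (Ident C x \<boxtimes> swap C (ihom C y z) (ihom C x y))"
  unfolding internal_comp_def Let_def by (rule eval_curry_left) (use assms in auto)

lemma flow_form_type [simp]:
  assumes "\<Psi> \<in> Arr C" "Dom C \<Psi> = T" "Cod C \<Psi> = ihom C X X" "X \<in> Obj C"
  shows "flow_form C T X \<Psi> \<in> Arr C" "Dom C (flow_form C T X \<Psi>) = T \<otimes> X"
    "Cod C (flow_form C T X \<Psi>) = X"
proof -
  have "T \<in> Obj C" using assms by auto
  then show "flow_form C T X \<Psi> \<in> Arr C" "Dom C (flow_form C T X \<Psi>) = T \<otimes> X"
    "Cod C (flow_form C T X \<Psi>) = X"
    using assms by (simp_all add: flow_form_def uncurry_left_def)
qed

lemma uncurry_eq_flow_form:
  assumes "\<Psi> \<in> Arr C" "Dom C \<Psi> = T" "Cod C \<Psi> = ihom C X X" "X \<in> Obj C"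
  shows "eval C X X \<cdot> (Ident C X \<boxtimes> \<Psi>) = flow_form C T X \<Psi> \<cdot> swap C X T"
proof -
  have "T \<in> Obj C" using assms by auto
  then show ?thesis
    using assms by (simp add: flow_form_def uncurry_left_def tensor_Id)
qed

lemma flow_form_surj:
  assumes "a \<in> Arr C" "Dom C a = T \<otimes> X" "Cod C a = X" "T \<in> Obj C" "X \<in> Obj C"
  obtains \<Psi> where "\<Psi> \<in> hom C T (ihom C X X)" "flow_form C T X \<Psi> = a"
proof
  let ?\<Psi> = "curry_left C X T X (a \<cdot> swap C X T)"
  show "?\<Psi> \<in> hom C T (ihom C X X)"
    using assms by (simp add: hom_iff)
  show "flow_form C T X ?\<Psi> = a"
    unfolding flow_form_def uncurry_left_def
    using assms by (subst eval_curry_left) auto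
qed

lemma functor_unit_iff:
  assumes \<Psi> [simp]: "\<Psi> \<in> Arr C" "Dom C \<Psi> = T" "Cod C \<Psi> = ihom C X X"
    and [simp]: "X \<in> Obj C" "\<iota> \<in> Arr C" "Dom C \<iota> = \<one>" "Cod C \<iota> = T"
  shows "\<Psi> \<cdot> \<iota> = internal_id C X \<longleftrightarrow> flow_form C T X \<Psi> \<cdot> (\<iota> \<boxtimes> Ident C X) = lunit C X"
proof -
  have [simp]: "T \<in> Obj C" using Dom_Obj[OF \<Psi>(1)] by simp
  let ?a = "flow_form C T X \<Psi>"
  have adj: "eval C X X \<cdot> (Ident C X \<boxtimes> \<Psi>) = ?a \<cdot> swap C X T"
    by (rule uncurry_eq_flow_form) simp_all
  have "eval C X X \<cdot> (Ident C X \<boxtimes> (\<Psi> \<cdot> \<iota>))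
      = eval C X X \<cdot> (Ident C X \<boxtimes> \<Psi>) \<cdot> (Ident C X \<boxtimes> \<iota>)"
    by (simp add: interchange)
  also have "\<dots> = ?a \<cdot> swap C X T \<cdot> (Ident C X \<boxtimes> \<iota>)"
    by (simp add: Comp_eq_tail[OF adj])
  also have "\<dots> = (?a \<cdot> (\<iota> \<boxtimes> Ident C X)) \<cdot> swap C X \<one>"
    by (simp add: swap_nat)
  finally have u: "eval C X X \<cdot> (Ident C X \<boxtimes> (\<Psi> \<cdot> \<iota>)) = (?a \<cdot> (\<iota> \<boxtimes> Ident C X)) \<cdot> swap C X \<one>" .
  have i: "eval C X X \<cdot> (Ident C X \<boxtimes> internal_id C X) = lunit C X \<cdot> swap C X \<one>"
    by (simp add: uncurry_internal_id lunit_swap)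
  show ?thesis
  proof
    assume eq: "\<Psi> \<cdot> \<iota> = internal_id C X"
    show "?a \<cdot> (\<iota> \<boxtimes> Ident C X) = lunit C X"
      by (rule iso_cancel_right[where e = "swap C X \<one>"]) (use eq u i in simp_all)
  next
    assume eq: "?a \<cdot> (\<iota> \<boxtimes> Ident C X) = lunit C X"
    show "\<Psi> \<cdot> \<iota> = internal_id C X"
      by (rule uncurry_left_inject[where y = X and z = X]) (use eq u i in simp_all)
  qed
qed

text \<open>Both sides of the composition law are uncurried to morphisms \<open>X \<otimes> (T \<otimes> T) \<rightarrow> X\<close>. They are the
  two sides of the action law precomposed with the symmetry that moves \<open>X\<close> to the right; for
  the internal composite this is \<open>swap_two_factors\<close>.\<close>

lemma functor_comp_iff:
  assumes \<Psi> [simp]: "\<Psi> \<in> Arr C" "Dom C \<Psi> = T" "Cod C \<Psi> = ihom C X X"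
    and [simp]: "X \<in> Obj C" "\<mu> \<in> Arr C" "Dom C \<mu> = T \<otimes> T" "Cod C \<mu> = T"
  shows "\<Psi> \<cdot> \<mu> = internal_comp C X X X \<cdot> (\<Psi> \<boxtimes> \<Psi>) \<longleftrightarrow>
    flow_form C T X \<Psi> \<cdot> (Ident C T \<boxtimes> flow_form C T X \<Psi>) \<cdot> assoc C T T X
      = flow_form C T X \<Psi> \<cdot> (\<mu> \<boxtimes> Ident C X)"
proof -
  have [simp]: "T \<in> Obj C" using Dom_Obj[OF \<Psi>(1)] by simp
  let ?a = "flow_form C T X \<Psi>" and ?E = "ihom C X X" and ?X = "Ident C X"
  let ?u = "eval C X X \<cdot> (?X \<boxtimes> \<Psi>)"
  let ?k = "inverse_arr C (assoc C X T T) \<cdot> (?X \<boxtimes> swap C T T)"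
  have adj: "?u = ?a \<cdot> swap C X T"
    by (rule uncurry_eq_flow_form) simp_all
  have "eval C X X \<cdot> (?X \<boxtimes> (\<Psi> \<cdot> \<mu>)) = eval C X X \<cdot> (?X \<boxtimes> \<Psi>) \<cdot> (?X \<boxtimes> \<mu>)"
    by (simp add: interchange)
  also have "\<dots> = ?a \<cdot> swap C X T \<cdot> (?X \<boxtimes> \<mu>)"
    by (simp add: Comp_eq_tail[OF adj])
  also have "\<dots> = (?a \<cdot> (\<mu> \<boxtimes> ?X)) \<cdot> swap C X (T \<otimes> T)"
    by (simp add: swap_nat)
  finally have l: "eval C X X \<cdot> (?X \<boxtimes> (\<Psi> \<cdot> \<mu>)) = (?a \<cdot> (\<mu> \<boxtimes> ?X)) \<cdot> swap C X (T \<otimes> T)" .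
  have "eval C X X \<cdot> (?X \<boxtimes> (internal_comp C X X X \<cdot> (\<Psi> \<boxtimes> \<Psi>)))
      = (eval C X X \<cdot> (?X \<boxtimes> internal_comp C X X X)) \<cdot> (?X \<boxtimes> \<Psi> \<boxtimes> \<Psi>)"
    by (simp add: interchange)
  also have "\<dots> = eval C X X \<cdot> (eval C X X \<boxtimes> Ident C ?E)
      \<cdot> inverse_arr C (assoc C X ?E ?E) \<cdot> (?X \<boxtimes> swap C ?E ?E) \<cdot> (?X \<boxtimes> \<Psi> \<boxtimes> \<Psi>)"
    by (simp add: uncurry_internal_comp)
  also have "\<dots> = eval C X X \<cdot> (eval C X X \<boxtimes> Ident C ?E)
      \<cdot> inverse_arr C (assoc C X ?E ?E) \<cdot> (?X \<boxtimes> \<Psi> \<boxtimes> \<Psi>) \<cdot> (?X \<boxtimes> swap C T T)"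
    by (simp add: interchange swap_nat)
  also have "\<dots> = eval C X X \<cdot> (eval C X X \<boxtimes> Ident C ?E) \<cdot> ((?X \<boxtimes> \<Psi>) \<boxtimes> \<Psi>) \<cdot> ?k"
    by (simp add: Comp_eq_tail[OF inverse_assoc_nat])
  also have "\<dots> = eval C X X \<cdot> (?X \<boxtimes> \<Psi>) \<cdot> (?u \<boxtimes> Ident C T) \<cdot> ?k"
    by (simp add: interchange_tail)
  also have "\<dots> = ?u \<cdot> (?u \<boxtimes> Ident C T) \<cdot> ?k"
    by simp
  also have "\<dots> = ?a \<cdot> swap C X T \<cdot> ((?a \<cdot> swap C X T) \<boxtimes> Ident C T) \<cdot> ?k"
    unfolding adj by simp
  also have "\<dots> = ?a \<cdot> (Ident C T \<boxtimes> (?a \<cdot> swap C X T)) \<cdot> swap C (X \<otimes> T) T \<cdot> ?k"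
    by (simp add: swap_nat_tail)
  also have "\<dots> = ?a \<cdot> (Ident C T \<boxtimes> ?a) \<cdot> (Ident C T \<boxtimes> swap C X T) \<cdot> swap C (X \<otimes> T) T \<cdot> ?k"
    by (simp add: interchange_tail)
  also have "\<dots> = (?a \<cdot> (Ident C T \<boxtimes> ?a) \<cdot> assoc C T T X) \<cdot> swap C X (T \<otimes> T)"
    by (simp add: swap_two_factors)
  finally have r: "eval C X X \<cdot> (?X \<boxtimes> (internal_comp C X X X \<cdot> (\<Psi> \<boxtimes> \<Psi>)))
      = (?a \<cdot> (Ident C T \<boxtimes> ?a) \<cdot> assoc C T T X) \<cdot> swap C X (T \<otimes> T)" .
  show ?thesis
  proof
    assume eq: "\<Psi> \<cdot> \<mu> = internal_comp C X X X \<cdot> (\<Psi> \<boxtimes> \<Psi>)"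
    show "?a \<cdot> (Ident C T \<boxtimes> ?a) \<cdot> assoc C T T X = ?a \<cdot> (\<mu> \<boxtimes> ?X)"
      by (rule iso_cancel_right[where e = "swap C X (T \<otimes> T)"]) (use eq l r in simp_all)
  next
    assume eq: "?a \<cdot> (Ident C T \<boxtimes> ?a) \<cdot> assoc C T T X = ?a \<cdot> (\<mu> \<boxtimes> ?X)"
    show "\<Psi> \<cdot> \<mu> = internal_comp C X X X \<cdot> (\<Psi> \<boxtimes> \<Psi>)"
      by (rule uncurry_left_inject[where y = X and z = X]) (use eq l r in simp_all)
  qed
qed

lemma enriched_functor_iff_left_action:
  assumes "one_object_enriched_category C T \<mu> \<iota>" "X \<in> Obj C" "\<Psi> \<in> hom C T (ihom C X X)"
  shows "enriched_functor C T \<mu> \<iota> X \<Psi> \<longleftrightarrow> left_action C T \<mu> \<iota> X (flow_form C T X \<Psi>)"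
  using assms functor_unit_iff[of \<Psi> T X \<iota>] functor_comp_iff[of \<Psi> T X \<mu>]
  by (simp add: enriched_functor_def left_action_def one_object_enriched_category_def hom_iff)


section \<open>The transfer operator\<close>

lemma transfer_operator_eq:
  assumes "T \<in> Obj C" "\<Omega> \<in> Obj C" "\<Phi> \<in> Arr C" "Dom C \<Phi> = T \<otimes> \<Omega>" "Cod C \<Phi> = \<Omega>"
  shows "transfer_operator C T \<Omega> \<Phi> = curry_left C T (T \<otimes> ihom C T \<Omega>) \<Omega>
    (\<Phi> \<cdot> (Ident C T \<boxtimes> eval C T \<Omega>) \<cdot> exchange T T (ihom C T \<Omega>))"
  using assms by (simp add: transfer_operator_def Let_def exchange_def)

lemma transfer_operator_type [simp]:
  assumes "T \<in> Obj C" "\<Omega> \<in> Obj C" "\<Phi> \<in> Arr C" "Dom C \<Phi> = T \<otimes> \<Omega>" "Cod C \<Phi> = \<Omega>"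
  shows "transfer_operator C T \<Omega> \<Phi> \<in> Arr C"
    "Dom C (transfer_operator C T \<Omega> \<Phi>) = T \<otimes> ihom C T \<Omega>"
    "Cod C (transfer_operator C T \<Omega> \<Phi>) = ihom C T \<Omega>"
  using assms by (simp_all add: transfer_operator_eq)

lemma eval_transfer_operator:
  assumes "T \<in> Obj C" "\<Omega> \<in> Obj C" "\<Phi> \<in> Arr C" "Dom C \<Phi> = T \<otimes> \<Omega>" "Cod C \<Phi> = \<Omega>"
  shows "eval C T \<Omega> \<cdot> (Ident C T \<boxtimes> transfer_operator C T \<Omega> \<Phi>)
    = \<Phi> \<cdot> (Ident C T \<boxtimes> eval C T \<Omega>) \<cdot> exchange T T (ihom C T \<Omega>)"
  unfolding transfer_operator_eq[OF assms] by (rule eval_curry_left) (use assms in auto)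

text \<open>Both identities are compared after evaluation at a time \<open>t\<close>, where they become those of
  \<open>\<Phi>\<close> at the state \<open>\<gamma>(t)\<close>.\<close>

lemma left_action_transfer_operator:
  assumes "one_object_enriched_category C T \<mu> \<iota>" "\<Omega> \<in> Obj C" "\<Phi> \<in> hom C (T \<otimes> \<Omega>) \<Omega>"
    and action: "left_action C T \<mu> \<iota> \<Omega> \<Phi>"
  shows "left_action C T \<mu> \<iota> (ihom C T \<Omega>) (transfer_operator C T \<Omega> \<Phi>)"
proof -
  have [simp]: "T \<in> Obj C" "\<mu> \<in> Arr C" "Dom C \<mu> = T \<otimes> T" "Cod C \<mu> = T"
      "\<iota> \<in> Arr C" "Dom C \<iota> = \<one>" "Cod C \<iota> = T"
      "\<Omega> \<in> Obj C" "\<Phi> \<in> Arr C" "Dom C \<Phi> = T \<otimes> \<Omega>" "Cod C \<Phi> = \<Omega>"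
    using assms by (auto simp: one_object_enriched_category_def hom_iff)
  have act_unit: "\<Phi> \<cdot> (\<iota> \<boxtimes> Ident C \<Omega>) = lunit C \<Omega>"
    and act_comp: "\<Phi> \<cdot> (Ident C T \<boxtimes> \<Phi>) \<cdot> assoc C T T \<Omega> = \<Phi> \<cdot> (\<mu> \<boxtimes> Ident C \<Omega>)"
    using action by (auto simp: left_action_def)
  let ?P = "ihom C T \<Omega>"
  let ?Tr = "transfer_operator C T \<Omega> \<Phi>" and ?T = "Ident C T" and ?ev = "eval C T \<Omega>"
  have ev: "?ev \<cdot> (?T \<boxtimes> ?Tr) = \<Phi> \<cdot> (?T \<boxtimes> ?ev) \<cdot> exchange T T ?P"
    by (rule eval_transfer_operator) auto
  have ev_tail: "?ev \<cdot> (?T \<boxtimes> ?Tr) \<cdot> k = \<Phi> \<cdot> (?T \<boxtimes> ?ev) \<cdot> exchange T T ?P \<cdot> k"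
    if "k \<in> Arr C" "Cod C k = T \<otimes> T \<otimes> ?P" for k
    using Comp_eq_tail[OF ev, of k] that by auto
  have unit: "?Tr \<cdot> (\<iota> \<boxtimes> Ident C ?P) = lunit C ?P"
  proof (rule uncurry_left_inject[where y = T and z = \<Omega>])
    have "?ev \<cdot> (?T \<boxtimes> (?Tr \<cdot> (\<iota> \<boxtimes> Ident C ?P)))
        = ?ev \<cdot> (?T \<boxtimes> ?Tr) \<cdot> (?T \<boxtimes> \<iota> \<boxtimes> Ident C ?P)"
      by (simp add: interchange)
    also have "\<dots> = \<Phi> \<cdot> (?T \<boxtimes> ?ev) \<cdot> exchange T T ?P \<cdot> (?T \<boxtimes> \<iota> \<boxtimes> Ident C ?P)"
      by (simp add: ev_tail)
    also have "\<dots> = \<Phi> \<cdot> (?T \<boxtimes> ?ev) \<cdot> (\<iota> \<boxtimes> Ident C (T \<otimes> ?P)) \<cdot> exchange T \<one> ?P"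
      by (simp add: exchange_nat tensor_Id)
    also have "\<dots> = \<Phi> \<cdot> (\<iota> \<boxtimes> Ident C \<Omega>) \<cdot> (Ident C \<one> \<boxtimes> ?ev) \<cdot> exchange T \<one> ?P"
      by (simp add: interchange_tail)
    also have "\<dots> = lunit C \<Omega> \<cdot> (Ident C \<one> \<boxtimes> ?ev) \<cdot> exchange T \<one> ?P"
      by (simp add: Comp_eq_tail[OF act_unit])
    also have "\<dots> = ?ev \<cdot> lunit C (T \<otimes> ?P) \<cdot> exchange T \<one> ?P"
      by (simp add: Comp_eq_tail[OF lunit_nat])
    also have "\<dots> = ?ev \<cdot> (?T \<boxtimes> lunit C ?P)"
      by (simp add: lunit_exchange)
    finally show "?ev \<cdot> (?T \<boxtimes> (?Tr \<cdot> (\<iota> \<boxtimes> Ident C ?P))) = ?ev \<cdot> (?T \<boxtimes> lunit C ?P)" .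
  qed simp_all
  have comp: "?Tr \<cdot> (?T \<boxtimes> ?Tr) \<cdot> assoc C T T ?P = ?Tr \<cdot> (\<mu> \<boxtimes> Ident C ?P)"
  proof (rule uncurry_left_inject[where y = T and z = \<Omega>])
    let ?m = "\<Phi> \<cdot> (?T \<boxtimes> \<Phi>) \<cdot> (?T \<boxtimes> ?T \<boxtimes> ?ev)
        \<cdot> assoc C T T (T \<otimes> ?P) \<cdot> exchange T (T \<otimes> T) ?P"
    have "?ev \<cdot> (?T \<boxtimes> (?Tr \<cdot> (?T \<boxtimes> ?Tr) \<cdot> assoc C T T ?P))
        = ?ev \<cdot> (?T \<boxtimes> ?Tr) \<cdot> (?T \<boxtimes> ?T \<boxtimes> ?Tr) \<cdot> (?T \<boxtimes> assoc C T T ?P)"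
      by (simp add: interchange)
    also have "\<dots> = \<Phi> \<cdot> (?T \<boxtimes> ?ev) \<cdot> exchange T T ?P
        \<cdot> (?T \<boxtimes> ?T \<boxtimes> ?Tr) \<cdot> (?T \<boxtimes> assoc C T T ?P)"
      by (simp add: ev_tail)
    also have "\<dots> = \<Phi> \<cdot> (?T \<boxtimes> ?ev) \<cdot> (?T \<boxtimes> ?T \<boxtimes> ?Tr)
        \<cdot> exchange T T (T \<otimes> ?P) \<cdot> (?T \<boxtimes> assoc C T T ?P)"
      by (simp add: exchange_nat_tail)
    also have "\<dots> = \<Phi> \<cdot> (?T \<boxtimes> (\<Phi> \<cdot> (?T \<boxtimes> ?ev) \<cdot> exchange T T ?P))
        \<cdot> exchange T T (T \<otimes> ?P) \<cdot> (?T \<boxtimes> assoc C T T ?P)"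
      by (simp add: interchange_tail ev)
    also have "\<dots> = \<Phi> \<cdot> (?T \<boxtimes> \<Phi>) \<cdot> (?T \<boxtimes> ?T \<boxtimes> ?ev) \<cdot> (?T \<boxtimes> exchange T T ?P)
        \<cdot> exchange T T (T \<otimes> ?P) \<cdot> (?T \<boxtimes> assoc C T T ?P)"
      by (simp add: interchange_tail)
    also have "\<dots> = ?m"
      by (simp add: exchange_assoc)
    finally have l: "?ev \<cdot> (?T \<boxtimes> (?Tr \<cdot> (?T \<boxtimes> ?Tr) \<cdot> assoc C T T ?P)) = ?m" .
    have "?ev \<cdot> (?T \<boxtimes> (?Tr \<cdot> (\<mu> \<boxtimes> Ident C ?P)))
        = ?ev \<cdot> (?T \<boxtimes> ?Tr) \<cdot> (?T \<boxtimes> \<mu> \<boxtimes> Ident C ?P)"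
      by (simp add: interchange)
    also have "\<dots> = \<Phi> \<cdot> (?T \<boxtimes> ?ev) \<cdot> exchange T T ?P \<cdot> (?T \<boxtimes> \<mu> \<boxtimes> Ident C ?P)"
      by (simp add: ev_tail)
    also have "\<dots> = \<Phi> \<cdot> (?T \<boxtimes> ?ev) \<cdot> (\<mu> \<boxtimes> Ident C (T \<otimes> ?P)) \<cdot> exchange T (T \<otimes> T) ?P"
      by (simp add: exchange_nat tensor_Id)
    also have "\<dots> = (\<Phi> \<cdot> (\<mu> \<boxtimes> Ident C \<Omega>)) \<cdot> (Ident C (T \<otimes> T) \<boxtimes> ?ev) \<cdot> exchange T (T \<otimes> T) ?P"
      by (simp add: interchange_tail)
    also have "\<dots> = (\<Phi> \<cdot> (?T \<boxtimes> \<Phi>) \<cdot> assoc C T T \<Omega>)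
        \<cdot> ((?T \<boxtimes> ?T) \<boxtimes> ?ev) \<cdot> exchange T (T \<otimes> T) ?P"
      by (simp only: act_comp tensor_Id \<open>T \<in> Obj C\<close>)
    also have "\<dots> = ?m"
      by (simp add: assoc_nat_tail)
    finally have r: "?ev \<cdot> (?T \<boxtimes> (?Tr \<cdot> (\<mu> \<boxtimes> Ident C ?P))) = ?m" .
    show "?ev \<cdot> (?T \<boxtimes> (?Tr \<cdot> (?T \<boxtimes> ?Tr) \<cdot> assoc C T T ?P))
        = ?ev \<cdot> (?T \<boxtimes> (?Tr \<cdot> (\<mu> \<boxtimes> Ident C ?P)))"
      unfolding l r ..
  qed simp_all
  from unit comp show ?thesis
    by (simp add: left_action_def)
qed

end

theorem theorem4:
  fixes C :: "('o, 'a, 'm) closed_symmetric_monoidal_category_scheme" (structure)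
    and T \<Omega> :: 'o
    and \<mu> \<iota> \<Phi>_sharp \<Phi> :: 'a
  defines "P \<equiv> ihom C T \<Omega>"
    and "Tr \<equiv> transfer_operator C T \<Omega> \<Phi>"
  assumes "closed_symmetric_monoidal_category C"
    and "one_object_enriched_category C T \<mu> \<iota>"
    and "enriched_functor C T \<mu> \<iota> \<Omega> \<Phi>_sharp"
    and "\<Phi> = flow_form C T \<Omega> \<Phi>_sharp"
  shows "Tr \<in> hom C (T \<otimes> P) P
    \<and> Tr \<cdot> (\<iota> \<boxtimes> Ident C P) = lunit C P
    \<and> Tr \<cdot> (Ident C T \<boxtimes> Tr) \<cdot> assoc C T T P = Tr \<cdot> (\<mu> \<boxtimes> Ident C P)
    \<and> (\<exists>Tr_sharp. enriched_functor C T \<mu> \<iota> P Tr_sharp \<and> Tr = flow_form C T P Tr_sharp)"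
proof -
  interpret closed_symmetric_monoidal_category C by fact
  have [simp]: "T \<in> Obj C" "\<Omega> \<in> Obj C" and sharp: "\<Phi>_sharp \<in> hom C T (ihom C \<Omega> \<Omega>)"
    using assms by (auto simp: one_object_enriched_category_def enriched_functor_def)
  have P [simp]: "P \<in> Obj C"
    by (simp add: P_def)
  have \<Phi>: "\<Phi> \<in> hom C (T \<otimes> \<Omega>) \<Omega>"
    using sharp assms(6) by (auto simp: hom_iff)
  have "left_action C T \<mu> \<iota> \<Omega> \<Phi>"
    using enriched_functor_iff_left_action[OF assms(4) _ sharp] assms(5,6) by simp
  then have action: "left_action C T \<mu> \<iota> P Tr"
    unfolding P_def Tr_def by (intro left_action_transfer_operator assms(4) \<Phi>) simp_all
  have Tr: "Tr \<in> hom C (T \<otimes> P) P"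
    using \<Phi> by (simp add: hom_iff Tr_def P_def)
  then have "Tr \<in> Arr C" "Dom C Tr = T \<otimes> P" "Cod C Tr = P"
    by (simp_all add: hom_iff)
  then obtain Tr_sharp
    where "Tr_sharp \<in> hom C T (ihom C P P)" and flow: "flow_form C T P Tr_sharp = Tr"
    by (rule flow_form_surj) simp_all
  then have "enriched_functor C T \<mu> \<iota> P Tr_sharp"
    using enriched_functor_iff_left_action[OF assms(4) P] action by simp
  with Tr action flow show ?thesis
    by (auto simp: left_action_def)
qed

end
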